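(* Let $T>0$, $d\ge1$, and let $g:\mathbb{R}^d\to\mathbb{R}$ be Lipschitz-continuous. Let $\varphi^\varepsilon$ and $\varphi^0$ be the solutions, with terminal condition $g$, of the viscous and first-order Hamilton-Jacobi equations with Hamiltonian $\frac12|p|^2$ (see context). There exists a constant $C>0$, independent of $\varepsilon$, $t$ and $x$, such that for every $(t,x)\in(0,T]\times\mathbb{R}^d$ and every $\varepsilon\in(0,1/2]$, $$\varphi^\varepsilon_t(x)-\varphi^0_t(x)\ge d\,\varepsilon\log\varepsilon-C\varepsilon .$$
   Context: For $\varepsilon>0$, $\varphi^\varepsilon$ is the unique classical ($\mathcal{C}^{1,2}$ on $[0,T)\times\mathbb{R}^d$, continuous up to $t=T$) solution with bounded gradient of $$-\partial_t\varphi^\varepsilon_t(x)+\frac12|\nabla\varphi^\varepsilon_t(x)|^2=\frac\varepsilon2\Delta\varphi^\varepsilon_t(x),\qquad \varphi^\varepsilon_T=g,$$ and $\varphi^0$ is the unique Lipschitz-continuous viscosity solution of $$-\partial_t\varphi^0_t(x)+\frac12|\nabla\varphi^0_t(x)|^2=0,\qquad \varphi^0_T=g.$$ *)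

theory Defs
  imports "HOL-Analysis.Analysis"
begin

text \<open>
  A function on \<open>[0,T] \<times> \<real>\<^sup>d\<close> is represented as \<open>u :: real \<Rightarrow> 'a \<Rightarrow> real\<close>, with \<open>u t x\<close> standing for
  \<open>u\<^sub>t(x)\<close>; its values at times outside \<open>[0,T]\<close> are never constrained.
\<close>

definition hamiltonian :: "'a::euclidean_space \<Rightarrow> real" where
  "hamiltonian p = (norm p)\<^sup>2 / 2"

text \<open>
  \<open>u\<close> is of class \<open>C\<^sup>1\<^sup>,\<^sup>2\<close> on \<open>[0,T) \<times> \<real>\<^sup>d\<close> with time derivative \<open>ut\<close>, spatial gradient \<open>Du\<close> and
  spatial Hessian \<open>D2u\<close> (as a linear map, the derivative of the gradient). Differentiating within
  \<open>[0,T)\<close> makes the time derivative one-sided at \<open>t = 0\<close> and two-sided elsewhere. Continuity of \<open>u\<close>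
  itself is part of \<open>viscous_HJ_solution\<close>, on the larger set \<open>[0,T] \<times> \<real>\<^sup>d\<close>.
\<close>

definition has_C12_derivatives ::
  "real \<Rightarrow> (real \<Rightarrow> 'a::euclidean_space \<Rightarrow> real) \<Rightarrow> (real \<Rightarrow> 'a \<Rightarrow> real) \<Rightarrow> (real \<Rightarrow> 'a \<Rightarrow> 'a)
    \<Rightarrow> (real \<Rightarrow> 'a \<Rightarrow> 'a \<Rightarrow>\<^sub>L 'a) \<Rightarrow> bool" where
  "has_C12_derivatives T u ut Du D2u \<longleftrightarrow>
     (\<forall>t\<in>{0..<T}. \<forall>x.
        ((\<lambda>s. u s x) has_real_derivative ut t x) (at t within {0..<T}) \<and>
        GDERIV (u t) x :> Du t x \<and>
        (Du t has_derivative blinfun_apply (D2u t x)) (at x)) \<and>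
     continuous_on ({0..<T} \<times> UNIV) (\<lambda>(t, x). ut t x) \<and>
     continuous_on ({0..<T} \<times> UNIV) (\<lambda>(t, x). Du t x) \<and>
     continuous_on ({0..<T} \<times> UNIV) (\<lambda>(t, x). D2u t x)"

definition blinfun_trace :: "('a::euclidean_space \<Rightarrow>\<^sub>L 'a) \<Rightarrow> real" where
  "blinfun_trace A = (\<Sum>b\<in>Basis. blinfun_apply A b \<bullet> b)"

text \<open>The Laplacian below is the trace of the Hessian.\<close>

definition viscous_HJ_solution ::
  "real \<Rightarrow> real \<Rightarrow> ('a::euclidean_space \<Rightarrow> real) \<Rightarrow> (real \<Rightarrow> 'a \<Rightarrow> real) \<Rightarrow> bool" where
  "viscous_HJ_solution \<epsilon> T g u \<longleftrightarrow>
     continuous_on ({0..T} \<times> UNIV) (\<lambda>(t, x). u t x) \<and>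
     (\<exists>ut Du D2u.
        has_C12_derivatives T u ut Du D2u \<and>
        (\<exists>M. \<forall>t\<in>{0..<T}. \<forall>x. norm (Du t x) \<le> M) \<and>
        (\<forall>t\<in>{0..<T}. \<forall>x.
           - ut t x + hamiltonian (Du t x) = \<epsilon> / 2 * blinfun_trace (D2u t x))) \<and>
     (\<forall>x. u T x = g x)"

text \<open>
  \<open>\<psi>\<close> is of class \<open>C\<^sup>1\<close> on \<open>(0,T) \<times> \<real>\<^sup>d\<close>, expressed through continuous partial derivatives.
\<close>

definition has_C1_derivatives ::
  "real \<Rightarrow> (real \<Rightarrow> 'a::euclidean_space \<Rightarrow> real) \<Rightarrow> (real \<Rightarrow> 'a \<Rightarrow> real) \<Rightarrow> (real \<Rightarrow> 'a \<Rightarrow> 'a) \<Rightarrow> bool"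
  where
  "has_C1_derivatives T \<psi> \<psi>t D\<psi> \<longleftrightarrow>
     (\<forall>t\<in>{0<..<T}. \<forall>x.
        ((\<lambda>s. \<psi> s x) has_real_derivative \<psi>t t x) (at t) \<and>
        GDERIV (\<psi> t) x :> D\<psi> t x) \<and>
     continuous_on ({0<..<T} \<times> UNIV) (\<lambda>(t, x). \<psi>t t x) \<and>
     continuous_on ({0<..<T} \<times> UNIV) (\<lambda>(t, x). D\<psi> t x)"

text \<open>
  Viscosity sub- and supersolutions of \<open>-\<partial>\<^sub>t u + |\<nabla>u|\<^sup>2/2 = 0\<close> on \<open>(0,T) \<times> \<real>\<^sup>d\<close>. The sign in front of
  \<open>\<partial>\<^sub>t u\<close> matters: the equation runs backward in time from the terminal condition.
\<close>

definition viscosity_subsolution ::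
  "real \<Rightarrow> (real \<Rightarrow> 'a::euclidean_space \<Rightarrow> real) \<Rightarrow> bool" where
  "viscosity_subsolution T u \<longleftrightarrow>
     (\<forall>\<psi> \<psi>t D\<psi>. has_C1_derivatives T \<psi> \<psi>t D\<psi> \<longrightarrow>
        (\<forall>t\<in>{0<..<T}. \<forall>x.
           (\<forall>\<^sub>F (s, y) in nhds (t, x). u s y - \<psi> s y \<le> u t x - \<psi> t x) \<longrightarrow>
           - \<psi>t t x + hamiltonian (D\<psi> t x) \<le> 0))"

definition viscosity_supersolution ::
  "real \<Rightarrow> (real \<Rightarrow> 'a::euclidean_space \<Rightarrow> real) \<Rightarrow> bool" where
  "viscosity_supersolution T u \<longleftrightarrow>
     (\<forall>\<psi> \<psi>t D\<psi>. has_C1_derivatives T \<psi> \<psi>t D\<psi> \<longrightarrow>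
        (\<forall>t\<in>{0<..<T}. \<forall>x.
           (\<forall>\<^sub>F (s, y) in nhds (t, x). u s y - \<psi> s y \<ge> u t x - \<psi> t x) \<longrightarrow>
           - \<psi>t t x + hamiltonian (D\<psi> t x) \<ge> 0))"

definition lipschitz_viscosity_HJ_solution ::
  "real \<Rightarrow> ('a::euclidean_space \<Rightarrow> real) \<Rightarrow> (real \<Rightarrow> 'a \<Rightarrow> real) \<Rightarrow> bool" where
  "lipschitz_viscosity_HJ_solution T g u \<longleftrightarrow>
     (\<exists>L. L-lipschitz_on ({0..T} \<times> UNIV) (\<lambda>(t, x). u t x)) \<and>
     viscosity_subsolution T u \<and> viscosity_supersolution T u \<and>
     (\<forall>x. u T x = g x)"

end

theory Submission
  imports Defs
begin

text \<open>
  By the Cole--Hopf transformation, \<open>w = exp (- u / \<epsilon>)\<close> turns the viscous equation into the backward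
  heat equation \<open>\<partial>\<^sub>t w + \<epsilon>/2 \<Delta>w = 0\<close>. For each \<open>y\<close>, the paraboloid
  \<open>v t x = g y + |x - y|\<^sup>2 / (2 (T + \<epsilon> - t))\<close> solves the first-order equation and is convex, so
  \<open>exp (- v / \<epsilon>)\<close> is a heat supersolution. Sums of such functions over \<open>O(\<epsilon> ^ (- d))\<close> grid points
  \<open>y\<close>, plus an exponential that takes care of infinity, dominate \<open>exp (- g / \<epsilon>)\<close> at time \<open>T\<close> up to a
  constant factor, hence dominate \<open>w\<close>. Since \<open>\<phi>0 \<le> v + O(\<epsilon>)\<close> because \<open>\<phi>0\<close> is a viscosity
  subsolution, \<open>w \<le> C \<epsilon> ^ (- d) exp (- \<phi>0 / \<epsilon>)\<close>; taking logarithms gives the theorem.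
\<close>

section \<open>Norms and coordinates\<close>

lemma norm_le_DIM_times:
  fixes x :: "'a::euclidean_space" and r :: real
  assumes "\<And>b. b \<in> Basis \<Longrightarrow> \<bar>x \<bullet> b\<bar> \<le> r"
  shows "norm x \<le> DIM('a) * r"
proof -
  have "norm x \<le> (\<Sum>b\<in>Basis. \<bar>x \<bullet> b\<bar>)" by (rule norm_le_l1)
  also have "\<dots> \<le> (\<Sum>b\<in>(Basis::'a set). r)" by (rule sum_mono) (use assms in auto)
  finally show ?thesis by simp
qed

text \<open>The exponential barrier is a sum over coordinate directions. Since the largest
  coordinate controls the norm up to the factor \<open>DIM('a)\<close>, a single summand will bound
  the barrier from below.\<close>

lemma obtain_dominant_coordinate:
  fixes x :: "'a::euclidean_space"
  obtains b where "b \<in> Basis" "norm x \<le> DIM('a) * \<bar>x \<bullet> b\<bar>"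
proof -
  define r where "r = Max ((\<lambda>b. \<bar>x \<bullet> b\<bar>) ` Basis)"
  have "r \<in> (\<lambda>b. \<bar>x \<bullet> b\<bar>) ` Basis" unfolding r_def by (rule Max_in) auto
  then obtain b where b: "b \<in> Basis" "r = \<bar>x \<bullet> b\<bar>" by auto
  have "norm x \<le> DIM('a) * r"
    by (rule norm_le_DIM_times) (auto simp: r_def)
  with b that show ?thesis by auto
qed

section \<open>Heat supersolutions and the minimum principle\<close>

text \<open>As \<open>f'\<close> is differentiable at 0 only, the argument goes through
  monotonicity: \<open>f' 0 = 0\<close>, so a negative \<open>c\<close> makes \<open>f'\<close>
  negative just to the right of 0 and \<open>f\<close> drops below \<open>f 0\<close>.\<close>

lemma second_derivative_nonneg_at_min:
  fixes f f' :: "real \<Rightarrow> real"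
  assumes f: "\<And>s. (f has_real_derivative f' s) (at s)"
    and f': "(f' has_real_derivative c) (at 0)"
    and min: "\<And>s. f 0 \<le> f s"
  shows "0 \<le> c"
proof (rule ccontr)
  assume "\<not> 0 \<le> c"
  then have "c < 0" by simp
  have "f' 0 = 0"
    by (rule DERIV_local_min[OF f, of 1]) (use min in auto)
  then obtain d where d: "d > 0" "\<And>h. 0 < h \<Longrightarrow> h < d \<Longrightarrow> f' h < 0"
    using DERIV_neg_dec_right[OF f' \<open>c < 0\<close>] by auto
  have "f (d/2) < f 0"
  proof (rule DERIV_neg_imp_decreasing_open[of 0 "d/2" f])
    show "\<exists>y. (f has_real_derivative y) (at s) \<and> y < 0" if "0 < s" "s < d/2" for s
      using f[of s] d(2)[of s] that d(1) by (intro exI[of _ "f' s"]) auto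
    show "continuous_on {0..d/2} f"
      using f by (intro continuous_at_imp_continuous_on) (auto intro: DERIV_isCont)
  qed (use d in auto)
  with min[of "d/2"] show False by simp
qed

text \<open>The functions \<open>u1 b\<close> and \<open>u2 b\<close> below are the first and second derivatives of \<open>u t\<close> in the
  coordinate direction \<open>b\<close>; mixed derivatives are not needed.\<close>

definition heat_supersolution :: "real \<Rightarrow> real \<Rightarrow> (real \<Rightarrow> 'a::euclidean_space \<Rightarrow> real) \<Rightarrow> bool" where
  "heat_supersolution \<epsilon> T u \<longleftrightarrow> (\<exists>ut u1 u2. \<forall>t\<in>{0..<T}. \<forall>x.
     ((\<lambda>s. u s x) has_real_derivative ut t x) (at t within {0..<T}) \<and>
     (\<forall>b\<in>Basis. ((\<lambda>s. u t (x + s *\<^sub>R b)) has_real_derivative u1 b t x) (at 0) \<and>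
                ((\<lambda>s. u1 b t (x + s *\<^sub>R b)) has_real_derivative u2 b t x) (at 0)) \<and>
     ut t x + \<epsilon> / 2 * (\<Sum>b\<in>Basis. u2 b t x) \<le> 0)"

lemma heat_supersolutionI:
  assumes "\<And>t x. 0 \<le> t \<Longrightarrow> t < T \<Longrightarrow> ((\<lambda>s. u s x) has_real_derivative ut t x) (at t within {0..<T})"
    and "\<And>t x b. 0 \<le> t \<Longrightarrow> t < T \<Longrightarrow> b \<in> Basis \<Longrightarrow>
           ((\<lambda>s. u t (x + s *\<^sub>R b)) has_real_derivative u1 b t x) (at 0)"
    and "\<And>t x b. 0 \<le> t \<Longrightarrow> t < T \<Longrightarrow> b \<in> Basis \<Longrightarrow>
           ((\<lambda>s. u1 b t (x + s *\<^sub>R b)) has_real_derivative u2 b t x) (at 0)"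
    and "\<And>t x. 0 \<le> t \<Longrightarrow> t < T \<Longrightarrow> ut t x + \<epsilon> / 2 * (\<Sum>b\<in>Basis. u2 b t x) \<le> 0"
  shows "heat_supersolution \<epsilon> T u"
  unfolding heat_supersolution_def using assms
  by (intro exI[of _ ut] exI[of _ u1] exI[of _ u2]) auto

lemma heat_supersolutionE:
  assumes "heat_supersolution \<epsilon> T u"
  obtains ut u1 u2 where
    "\<And>t x. 0 \<le> t \<Longrightarrow> t < T \<Longrightarrow> ((\<lambda>s. u s x) has_real_derivative ut t x) (at t within {0..<T})"
    "\<And>t x b. 0 \<le> t \<Longrightarrow> t < T \<Longrightarrow> b \<in> Basis \<Longrightarrow>
       ((\<lambda>s. u t (x + s *\<^sub>R b)) has_real_derivative u1 b t x) (at 0)"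
    "\<And>t x b. 0 \<le> t \<Longrightarrow> t < T \<Longrightarrow> b \<in> Basis \<Longrightarrow>
       ((\<lambda>s. u1 b t (x + s *\<^sub>R b)) has_real_derivative u2 b t x) (at 0)"
    "\<And>t x. 0 \<le> t \<Longrightarrow> t < T \<Longrightarrow> ut t x + \<epsilon> / 2 * (\<Sum>b\<in>Basis. u2 b t x) \<le> 0"
proof -
  from assms obtain ut u1 u2 where "\<forall>t\<in>{0..<T}. \<forall>x.
     ((\<lambda>s. u s x) has_real_derivative ut t x) (at t within {0..<T}) \<and>
     (\<forall>b\<in>Basis. ((\<lambda>s. u t (x + s *\<^sub>R b)) has_real_derivative u1 b t x) (at 0) \<and>
                ((\<lambda>s. u1 b t (x + s *\<^sub>R b)) has_real_derivative u2 b t x) (at 0)) \<and>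
     ut t x + \<epsilon> / 2 * (\<Sum>b\<in>Basis. u2 b t x) \<le> 0"
    unfolding heat_supersolution_def by blast
  then show ?thesis by (intro that[of ut u1 u2]) auto
qed

lemma heat_supersolution_0: "heat_supersolution \<epsilon> T (\<lambda>t x. 0)"
  by (rule heat_supersolutionI[where ut="\<lambda>t x. 0" and ?u1.0="\<lambda>b t x. 0" and ?u2.0="\<lambda>b t x. 0"]) auto

lemma heat_supersolution_add:
  assumes "heat_supersolution \<epsilon> T u" "heat_supersolution \<epsilon> T v"
  shows "heat_supersolution \<epsilon> T (\<lambda>t x. u t x + v t x)"
proof -
  obtain ut u1 u2 where u:
    "\<And>t x. 0 \<le> t \<Longrightarrow> t < T \<Longrightarrow> ((\<lambda>s. u s x) has_real_derivative ut t x) (at t within {0..<T})"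
    "\<And>t x b. 0 \<le> t \<Longrightarrow> t < T \<Longrightarrow> b \<in> Basis \<Longrightarrow>
       ((\<lambda>s. u t (x + s *\<^sub>R b)) has_real_derivative u1 b t x) (at 0)"
    "\<And>t x b. 0 \<le> t \<Longrightarrow> t < T \<Longrightarrow> b \<in> Basis \<Longrightarrow>
       ((\<lambda>s. u1 b t (x + s *\<^sub>R b)) has_real_derivative u2 b t x) (at 0)"
    "\<And>t x. 0 \<le> t \<Longrightarrow> t < T \<Longrightarrow> ut t x + \<epsilon> / 2 * (\<Sum>b\<in>Basis. u2 b t x) \<le> 0"
    using heat_supersolutionE[OF assms(1)] by blast
  obtain vt v1 v2 where v:
    "\<And>t x. 0 \<le> t \<Longrightarrow> t < T \<Longrightarrow> ((\<lambda>s. v s x) has_real_derivative vt t x) (at t within {0..<T})"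
    "\<And>t x b. 0 \<le> t \<Longrightarrow> t < T \<Longrightarrow> b \<in> Basis \<Longrightarrow>
       ((\<lambda>s. v t (x + s *\<^sub>R b)) has_real_derivative v1 b t x) (at 0)"
    "\<And>t x b. 0 \<le> t \<Longrightarrow> t < T \<Longrightarrow> b \<in> Basis \<Longrightarrow>
       ((\<lambda>s. v1 b t (x + s *\<^sub>R b)) has_real_derivative v2 b t x) (at 0)"
    "\<And>t x. 0 \<le> t \<Longrightarrow> t < T \<Longrightarrow> vt t x + \<epsilon> / 2 * (\<Sum>b\<in>Basis. v2 b t x) \<le> 0"
    using heat_supersolutionE[OF assms(2)] by blast
  show ?thesis
  proof (rule heat_supersolutionI[where ut="\<lambda>t x. ut t x + vt t x"
        and ?u1.0="\<lambda>b t x. u1 b t x + v1 b t x" and ?u2.0="\<lambda>b t x. u2 b t x + v2 b t x"])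
    fix t and x :: 'a assume "0 \<le> t" "t < T"
    from u(4)[OF this, of x] v(4)[OF this, of x]
    show "ut t x + vt t x + \<epsilon> / 2 * (\<Sum>b\<in>Basis. u2 b t x + v2 b t x) \<le> 0"
      by (simp add: sum.distrib distrib_left)
  qed (auto intro!: DERIV_add u v)
qed

lemma heat_supersolution_cmult:
  assumes "heat_supersolution \<epsilon> T u" "0 \<le> c"
  shows "heat_supersolution \<epsilon> T (\<lambda>t x. c * u t x)"
proof -
  obtain ut u1 u2 where u:
    "\<And>t x. 0 \<le> t \<Longrightarrow> t < T \<Longrightarrow> ((\<lambda>s. u s x) has_real_derivative ut t x) (at t within {0..<T})"
    "\<And>t x b. 0 \<le> t \<Longrightarrow> t < T \<Longrightarrow> b \<in> Basis \<Longrightarrow>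
       ((\<lambda>s. u t (x + s *\<^sub>R b)) has_real_derivative u1 b t x) (at 0)"
    "\<And>t x b. 0 \<le> t \<Longrightarrow> t < T \<Longrightarrow> b \<in> Basis \<Longrightarrow>
       ((\<lambda>s. u1 b t (x + s *\<^sub>R b)) has_real_derivative u2 b t x) (at 0)"
    "\<And>t x. 0 \<le> t \<Longrightarrow> t < T \<Longrightarrow> ut t x + \<epsilon> / 2 * (\<Sum>b\<in>Basis. u2 b t x) \<le> 0"
    using heat_supersolutionE[OF assms(1)] by blast
  show ?thesis
  proof (rule heat_supersolutionI[where ut="\<lambda>t x. c * ut t x"
        and ?u1.0="\<lambda>b t x. c * u1 b t x" and ?u2.0="\<lambda>b t x. c * u2 b t x"])
    fix t and x :: 'a assume "0 \<le> t" "t < T"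
    from mult_left_mono[OF u(4)[OF this, of x] \<open>0 \<le> c\<close>]
    show "c * ut t x + \<epsilon> / 2 * (\<Sum>b\<in>Basis. c * u2 b t x) \<le> 0"
      by (simp add: sum_distrib_left[symmetric] algebra_simps)
  qed (auto intro!: DERIV_cmult u)
qed

lemma heat_supersolution_sum:
  assumes "finite I" "\<And>i. i \<in> I \<Longrightarrow> heat_supersolution \<epsilon> T (u i)"
  shows "heat_supersolution \<epsilon> T (\<lambda>t x. \<Sum>i\<in>I. u i t x)"
  using assms
  by (induction I rule: finite_induct) (auto intro: heat_supersolution_0 heat_supersolution_add)

text \<open>If \<open>u\<close> were negative somewhere, then
  \<open>u s z + \<eta> * (T - s)\<close> would have a negative minimum, attained in a compact
  cylinder by \<open>far\<close> and before time \<open>T\<close> by \<open>terminal\<close>. There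
  the second space derivatives are nonnegative, so \<open>ut\<close> is nonpositive, and the
  perturbation makes the time derivative strictly negative: the function decreases further just
  after the minimum.\<close>

lemma heat_minimum_principle:
  fixes u :: "real \<Rightarrow> 'a::euclidean_space \<Rightarrow> real"
  assumes super: "heat_supersolution \<epsilon> T u" and "0 < \<epsilon>"
    and cont: "continuous_on ({0..T} \<times> UNIV) (\<lambda>(t, x). u t x)"
    and terminal: "\<And>x. 0 \<le> u T x"
    and far: "\<And>t x. 0 \<le> t \<Longrightarrow> t \<le> T \<Longrightarrow> R \<le> dist x0 x \<Longrightarrow> 0 \<le> u t x"
    and t: "0 \<le> t" "t \<le> T"
  shows "0 \<le> u t x"
proof (rule ccontr)
  assume "\<not> 0 \<le> u t x"
  then have neg: "u t x < 0" by simp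
  obtain ut u1 u2 where u:
    "\<And>t x. 0 \<le> t \<Longrightarrow> t < T \<Longrightarrow> ((\<lambda>s. u s x) has_real_derivative ut t x) (at t within {0..<T})"
    "\<And>t x b. 0 \<le> t \<Longrightarrow> t < T \<Longrightarrow> b \<in> Basis \<Longrightarrow>
       ((\<lambda>s. u t (x + s *\<^sub>R b)) has_real_derivative u1 b t x) (at 0)"
    "\<And>t x b. 0 \<le> t \<Longrightarrow> t < T \<Longrightarrow> b \<in> Basis \<Longrightarrow>
       ((\<lambda>s. u1 b t (x + s *\<^sub>R b)) has_real_derivative u2 b t x) (at 0)"
    "\<And>t x. 0 \<le> t \<Longrightarrow> t < T \<Longrightarrow> ut t x + \<epsilon> / 2 * (\<Sum>b\<in>Basis. u2 b t x) \<le> 0"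
    using heat_supersolutionE[OF super] by blast
  \<comment> \<open>The perturbation at \<open>(t, x)\<close> then uses up at most half of the
    negative value \<open>u t x\<close>. The summand 1 keeps the denominator positive when
    \<open>T = 0\<close>.\<close>
  define \<eta> where "\<eta> = - u t x / (2 * (T + 1))"
  have "\<eta> > 0" using neg t by (simp add: \<eta>_def field_simps)
  define f where "f = (\<lambda>(s, z). u s z + \<eta> * (T - s))"
  have "u t x + \<eta> * (T - t) < 0"
  proof -
    have "\<eta> * (T - t) \<le> \<eta> * (T + 1)" using t \<open>\<eta> > 0\<close> by (intro mult_left_mono) auto
    also have "\<dots> = - u t x / 2"
      unfolding \<eta>_def using t by (simp add: divide_simps)
    finally show ?thesis using neg by simp
  qed
  then have ftx: "f (t, x) < 0" by (simp add: f_def)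
  \<comment> \<open>All points of the strip where \<open>f\<close> is negative lie in
    \<open>S\<close>, so the minimum over \<open>S\<close> is a minimum over the whole
    strip.\<close>
  define S where "S = {0..T} \<times> cball x0 R"
  have inS: "(s, z) \<in> S" if "0 \<le> s" "s \<le> T" "f (s, z) < 0" for s z
  proof -
    have "0 \<le> \<eta> * (T - s)" using that \<open>\<eta> > 0\<close> by simp
    then have "u s z < 0" using that by (simp add: f_def)
    then have "dist x0 z \<le> R" using far[of s z] that by linarith
    then show ?thesis using that by (simp add: S_def)
  qed
  have "compact S" unfolding S_def by (intro compact_Times) auto
  moreover have "S \<noteq> {}" using inS[OF t ftx] by auto
  moreover have "continuous_on S f" unfolding f_def case_prod_beta
    by (intro continuous_intros continuous_on_subset[OF cont[unfolded case_prod_beta]])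
      (auto simp: S_def)
  ultimately obtain p where p: "p \<in> S" "\<And>q. q \<in> S \<Longrightarrow> f p \<le> f q"
    using continuous_attains_inf[of S f] by auto
  obtain s z where sz: "p = (s, z)" by force
  have fneg: "f (s, z) < 0" using p(2)[OF inS[OF t ftx]] ftx sz by simp
  have min: "f (s, z) \<le> f (s', z')" if "0 \<le> s'" "s' \<le> T" for s' z'
  proof (cases "f (s', z') < 0")
    case True
    then show ?thesis using p(2) inS[OF that] sz by auto
  next
    case False
    then show ?thesis using fneg by linarith
  qed
  have s: "0 \<le> s" "s \<le> T" using p(1) sz by (auto simp: S_def)
  have "s \<noteq> T" using fneg terminal[of z] by (auto simp: f_def)
  with s have "s < T" by simp
  have "0 \<le> u2 b s z" if b: "b \<in> Basis" for b
  proof (rule second_derivative_nonneg_at_min[of "\<lambda>r. u s (z + r *\<^sub>R b)" "\<lambda>r. u1 b s (z + r *\<^sub>R b)"])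
    fix r
    show "((\<lambda>r. u s (z + r *\<^sub>R b)) has_real_derivative u1 b s (z + r *\<^sub>R b)) (at r)"
      using u(2)[OF s(1) \<open>s < T\<close> b, of "z + r *\<^sub>R b"] DERIV_shift[of "\<lambda>r. u s (z + r *\<^sub>R b)" _ 0 r]
      by (simp add: algebra_simps)
    show "u s (z + 0 *\<^sub>R b) \<le> u s (z + r *\<^sub>R b)"
      using min[of s "z + r *\<^sub>R b"] s by (simp add: f_def)
  qed (use u(3)[OF s(1) \<open>s < T\<close> b] in simp)
  then have "0 \<le> \<epsilon> / 2 * (\<Sum>b\<in>Basis. u2 b s z)"
    using \<open>0 < \<epsilon>\<close> by (intro mult_nonneg_nonneg sum_nonneg) auto
  then have "ut s z \<le> 0" using u(4)[OF s(1) \<open>s < T\<close>, of z] by linarith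
  \<comment> \<open>The contradiction comes from moving forward in time, so a minimum at
    \<open>s = 0\<close>, where the derivative is one-sided, is covered as well.\<close>
  have "((\<lambda>r. u r z + \<eta> * (T - r)) has_real_derivative ut s z - \<eta>) (at s within {0..<T})"
    using u(1)[OF s(1) \<open>s < T\<close>, of z] by (auto intro!: derivative_eq_intros)
  moreover have "ut s z - \<eta> < 0" using \<open>ut s z \<le> 0\<close> \<open>\<eta> > 0\<close> by simp
  ultimately obtain d where d: "d > 0"
    "\<And>h. 0 < h \<Longrightarrow> s + h \<in> {0..<T} \<Longrightarrow> h < d \<Longrightarrow> u (s + h) z + \<eta> * (T - (s + h)) < u s z + \<eta> * (T - s)"
    using has_real_derivative_neg_dec_right by blast
  define h where "h = min d (T - s) / 2"
  have "0 < h" "h < d" "s + h < T" using d(1) \<open>s < T\<close> by (auto simp: h_def min_def field_simps)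
  then show False using d(2)[of h] s min[of "s + h" z] by (auto simp: f_def)
qed

section \<open>Gaussian and exponential supersolutions\<close>

text \<open>This is a backward heat kernel without its prefactor \<open>(T + \<delta> - t)\<close>
  to the power \<open>-d/2\<close>. That prefactor would give an exact solution; without it the heat
  operator yields \<open>- d / (2 * (T + \<delta> - t))\<close> times the Gaussian, which has the
  right sign. The shift \<open>\<delta>\<close> keeps the function regular up to time
  \<open>T\<close>.\<close>

lemma heat_supersolution_gaussian:
  fixes y :: "'a::euclidean_space"
  assumes "0 < \<epsilon>" "0 < \<delta>"
  shows "heat_supersolution \<epsilon> T (\<lambda>t x. exp (- (c + (norm (x - y))\<^sup>2 / (2 * (T + \<delta> - t))) / \<epsilon>))"
proof -
  define G where "G t x = exp (- (c + (norm (x - y))\<^sup>2 / (2 * (T + \<delta> - t))) / \<epsilon>)" for t and x :: 'a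
  define p where "p b t x = ((x - y) \<bullet> b) / (T + \<delta> - t)" for b t and x :: 'a
  have sq_line: "(norm (x + s *\<^sub>R b - y))\<^sup>2 = (norm (x - y))\<^sup>2 + 2 * s * ((x - y) \<bullet> b) + s\<^sup>2"
    if "b \<in> Basis" for x b :: 'a and s
  proof -
    have "x + s *\<^sub>R b - y = (x - y) + s *\<^sub>R b" by simp
    also have "(norm \<dots>)\<^sup>2 = (norm (x - y))\<^sup>2 + 2 * s * ((x - y) \<bullet> b) + s\<^sup>2"
      using that unfolding power2_norm_eq_inner
      by (simp add: inner_add_left inner_add_right inner_commute power2_eq_square)
    finally show ?thesis .
  qed
  have p_line: "p b t (x + s *\<^sub>R b) = p b t x + s / (T + \<delta> - t)" if "b \<in> Basis" for x b :: 'a and s t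
    using that by (simp add: p_def inner_diff_left inner_add_left add_divide_distrib diff_divide_distrib)
  have G1: "((\<lambda>s. G t (x + s *\<^sub>R b)) has_real_derivative - (p b t x / \<epsilon>) * G t x) (at 0)"
    if "t < T" "b \<in> Basis" for t b x
  proof -
    have "((\<lambda>s. - (c + ((norm (x - y))\<^sup>2 + 2 * s * q + s\<^sup>2) / (2 * r)) / \<epsilon>)
        has_real_derivative - (q / r / \<epsilon>)) (at 0)" if "r > 0" for q r
      using that assms by (auto intro!: derivative_eq_intros)
    from this[of "T + \<delta> - t" "(x - y) \<bullet> b"]
    have "((\<lambda>s. - (c + ((norm (x - y))\<^sup>2 + 2 * s * ((x - y) \<bullet> b) + s\<^sup>2) / (2 * (T + \<delta> - t))) / \<epsilon>)
        has_real_derivative - (p b t x / \<epsilon>)) (at 0)"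
      unfolding p_def using that assms by simp
    from DERIV_fun_exp[OF this] show ?thesis
      unfolding G_def sq_line[OF that(2)] by (simp add: mult.commute)
  qed
  have "heat_supersolution \<epsilon> T G"
  proof (rule heat_supersolutionI[where ut="\<lambda>t x. - ((norm (x - y))\<^sup>2 / (2 * (T + \<delta> - t)\<^sup>2) / \<epsilon>) * G t x"
        and ?u1.0="\<lambda>b t x. - (p b t x / \<epsilon>) * G t x"
        and ?u2.0="\<lambda>b t x. ((p b t x)\<^sup>2 / \<epsilon>\<^sup>2 - 1 / ((T + \<delta> - t) * \<epsilon>)) * G t x"])
    fix t and x :: 'a assume t: "0 \<le> t" "t < T"
    have D: "((\<lambda>r. - (c + (norm (x - y))\<^sup>2 / (2 * r)) / \<epsilon>) has_real_derivative
        (norm (x - y))\<^sup>2 / (2 * r\<^sup>2) / \<epsilon>) (at r)" if "r > 0" for r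
      using that assms by (auto intro!: derivative_eq_intros simp: power2_eq_square)
    have "((\<lambda>s. T + \<delta> - s) has_real_derivative - 1) (at t)"
      by (auto intro!: derivative_eq_intros)
    from DERIV_chain2[OF D this] t assms
    have "((\<lambda>s. - (c + (norm (x - y))\<^sup>2 / (2 * (T + \<delta> - s))) / \<epsilon>) has_real_derivative
        - ((norm (x - y))\<^sup>2 / (2 * (T + \<delta> - t)\<^sup>2) / \<epsilon>)) (at t)"
      by simp
    from DERIV_fun_exp[OF this] show "((\<lambda>s. G s x) has_real_derivative
        - ((norm (x - y))\<^sup>2 / (2 * (T + \<delta> - t)\<^sup>2) / \<epsilon>) * G t x) (at t within {0..<T})"
      unfolding G_def by (simp only: mult.commute has_field_derivative_at_within)
    have sq: "(\<Sum>b\<in>Basis. ((x - y) \<bullet> b)\<^sup>2) = (norm (x - y))\<^sup>2"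
      unfolding power2_norm_eq_inner by (subst euclidean_inner) (simp add: power2_eq_square)
    have "(\<Sum>b\<in>(Basis::'a set). (p b t x)\<^sup>2 / \<epsilon>\<^sup>2 - 1 / ((T + \<delta> - t) * \<epsilon>))
        = (norm (x - y))\<^sup>2 / (T + \<delta> - t)\<^sup>2 / \<epsilon>\<^sup>2 - DIM('a) / ((T + \<delta> - t) * \<epsilon>)"
      by (simp add: p_def sum_subtractf power_divide sum_divide_distrib[symmetric] sq)
    \<comment> \<open>Here \<open>q\<close> is the squared distance, \<open>r\<close> the shifted
      remaining time, \<open>h\<close> the Gaussian and \<open>n\<close> the dimension. The
      \<open>q\<close> terms cancel because the paraboloid solves the first-order equation; what is
      left is its Laplacian.\<close>
    moreover have "- (q / (2 * r\<^sup>2) / \<epsilon>) * h + \<epsilon> / 2 * ((q / r\<^sup>2 / \<epsilon>\<^sup>2 - n / (r * \<epsilon>)) * h) = - (n / (2 * r) * h)"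
      if "r > 0" for q r n h :: real
      using that assms by (simp add: field_simps power2_eq_square)
    ultimately have "- ((norm (x - y))\<^sup>2 / (2 * (T + \<delta> - t)\<^sup>2) / \<epsilon>) * G t x + \<epsilon> / 2 *
        (\<Sum>b\<in>Basis. ((p b t x)\<^sup>2 / \<epsilon>\<^sup>2 - 1 / ((T + \<delta> - t) * \<epsilon>)) * G t x)
        = - (DIM('a) / (2 * (T + \<delta> - t)) * G t x)"
      using assms t by (simp only: sum_distrib_right[symmetric])
    also have "\<dots> \<le> 0" using assms t by (simp add: G_def)
    finally show "- ((norm (x - y))\<^sup>2 / (2 * (T + \<delta> - t)\<^sup>2) / \<epsilon>) * G t x + \<epsilon> / 2 *
        (\<Sum>b\<in>Basis. ((p b t x)\<^sup>2 / \<epsilon>\<^sup>2 - 1 / ((T + \<delta> - t) * \<epsilon>)) * G t x) \<le> 0" .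
    fix b :: 'a assume b: "b \<in> Basis"
    show "((\<lambda>s. - (p b t (x + s *\<^sub>R b) / \<epsilon>) * G t (x + s *\<^sub>R b)) has_real_derivative
        ((p b t x)\<^sup>2 / \<epsilon>\<^sup>2 - 1 / ((T + \<delta> - t) * \<epsilon>)) * G t x) (at 0)"
    proof -
      have "((\<lambda>s. - ((p b t x + s / (T + \<delta> - t)) / \<epsilon>)) has_real_derivative
          - (1 / ((T + \<delta> - t) * \<epsilon>))) (at 0)"
        using t assms by (auto intro!: derivative_eq_intros)
      from DERIV_mult[OF this G1[OF t(2) b]] show ?thesis
        unfolding p_line[OF b] by (simp add: algebra_simps power2_eq_square)
    qed
  qed (use G1 in auto)
  then show ?thesis unfolding G_def .
qed

lemma heat_supersolution_exp:
  fixes a x0 :: "'a::euclidean_space"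
  shows "heat_supersolution \<epsilon> T (\<lambda>t x. exp (a \<bullet> (x - x0) + \<epsilon> / 2 * (norm a)\<^sup>2 * (T - t)))"
proof -
  define E where "E t x = exp (a \<bullet> (x - x0) + \<epsilon> / 2 * (norm a)\<^sup>2 * (T - t))" for t and x :: 'a
  have E1: "((\<lambda>s. E t (x + s *\<^sub>R b)) has_real_derivative (a \<bullet> b) * E t x) (at 0)" for t x b
    unfolding E_def by (auto intro!: derivative_eq_intros simp: algebra_simps)
  have "heat_supersolution \<epsilon> T E"
  proof (rule heat_supersolutionI[where ut="\<lambda>t x. - (\<epsilon> / 2 * (norm a)\<^sup>2) * E t x"
        and ?u1.0="\<lambda>b t x. (a \<bullet> b) * E t x" and ?u2.0="\<lambda>b t x. (a \<bullet> b) * ((a \<bullet> b) * E t x)"])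
    fix t and x :: 'a
    show "((\<lambda>s. E s x) has_real_derivative - (\<epsilon> / 2 * (norm a)\<^sup>2) * E t x) (at t within {0..<T})"
      unfolding E_def by (auto intro!: derivative_eq_intros)
    have "(\<Sum>b\<in>Basis. (a \<bullet> b) * ((a \<bullet> b) * E t x)) = (norm a)\<^sup>2 * E t x"
      by (simp add: power2_norm_eq_inner euclidean_inner[of a a] sum_distrib_right mult.assoc)
    then show "- (\<epsilon> / 2 * (norm a)\<^sup>2) * E t x + \<epsilon> / 2 * (\<Sum>b\<in>Basis. (a \<bullet> b) * ((a \<bullet> b) * E t x)) \<le> 0"
      by simp
  qed (auto intro!: E1 DERIV_cmult)
  then show ?thesis unfolding E_def .
qed

section \<open>The Cole--Hopf transform\<close>

lemma has_vector_derivative_along_line: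
  assumes "(f has_derivative f') (at x)"
  shows "((\<lambda>s. f (x + s *\<^sub>R b)) has_vector_derivative f' b) (at 0)"
proof -
  have "((\<lambda>s. x + s *\<^sub>R b) has_derivative (\<lambda>s. s *\<^sub>R b)) (at 0)"
    by (auto intro!: derivative_eq_intros)
  moreover have "(f has_derivative f') (at (x + 0 *\<^sub>R b))" using assms by simp
  ultimately have "((\<lambda>s. f (x + s *\<^sub>R b)) has_derivative (\<lambda>s. f' (s *\<^sub>R b))) (at 0)"
    by (rule has_derivative_compose)
  then show ?thesis
    using linear_scale[OF has_derivative_linear[OF assms]] by (simp add: has_vector_derivative_def)
qed

text \<open>The heat operator applied to \<open>- w\<close> is \<open>w / \<epsilon>\<close> times
  the residual of the viscous equation, hence zero. The negative sign is the one needed later, where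
  \<open>- w\<close> is added to a supersolution in order to apply the minimum principle.\<close>

lemma heat_supersolution_neg_exp_viscous:
  fixes u :: "real \<Rightarrow> 'a::euclidean_space \<Rightarrow> real"
  assumes "viscous_HJ_solution \<epsilon> T g u" "0 < \<epsilon>"
  shows "heat_supersolution \<epsilon> T (\<lambda>t x. - exp (- u t x / \<epsilon>))"
proof -
  obtain ut Du D2u where C12: "has_C12_derivatives T u ut Du D2u"
    and eq: "\<And>t x. 0 \<le> t \<Longrightarrow> t < T \<Longrightarrow>
      - ut t x + hamiltonian (Du t x) = \<epsilon> / 2 * blinfun_trace (D2u t x)"
    using assms(1) unfolding viscous_HJ_solution_def by auto
  have dt: "((\<lambda>s. u s x) has_real_derivative ut t x) (at t within {0..<T})"
    and dx: "(u t has_derivative (\<lambda>h. h \<bullet> Du t x)) (at x)"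
    and dxx: "(Du t has_derivative blinfun_apply (D2u t x)) (at x)" if "0 \<le> t" "t < T" for t x
    using C12 that by (auto simp: has_C12_derivatives_def gderiv_def)
  define w where "w t x = exp (- u t x / \<epsilon>)" for t x
  have dx_line: "((\<lambda>s. u t (x + s *\<^sub>R b)) has_real_derivative Du t x \<bullet> b) (at 0)"
    if "0 \<le> t" "t < T" for t x b
    using has_vector_derivative_along_line[OF dx[OF that]]
    by (simp add: has_real_derivative_iff_has_vector_derivative inner_commute)
  have dxx_line: "((\<lambda>s. Du t (x + s *\<^sub>R b) \<bullet> b) has_real_derivative blinfun_apply (D2u t x) b \<bullet> b) (at 0)"
    if "0 \<le> t" "t < T" for t x b
    using bounded_linear.has_vector_derivative[OF bounded_linear_inner_left
        has_vector_derivative_along_line[OF dxx[OF that]]]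
    by (simp add: has_real_derivative_iff_has_vector_derivative)
  have w_line: "((\<lambda>s. w t (x + s *\<^sub>R b)) has_real_derivative - (Du t x \<bullet> b) / \<epsilon> * w t x) (at 0)"
    if "0 \<le> t" "t < T" for t x b
    using DERIV_fun_exp[OF DERIV_cdivide[OF DERIV_minus[OF dx_line[OF that]]]]
    by (simp add: w_def mult.commute)
  have "heat_supersolution \<epsilon> T (\<lambda>t x. - w t x)"
  proof (rule heat_supersolutionI[where ut="\<lambda>t x. ut t x / \<epsilon> * w t x"
        and ?u1.0="\<lambda>b t x. Du t x \<bullet> b / \<epsilon> * w t x"
        and ?u2.0="\<lambda>b t x. (blinfun_apply (D2u t x) b \<bullet> b / \<epsilon> - (Du t x \<bullet> b)\<^sup>2 / \<epsilon>\<^sup>2) * w t x"])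
    fix t and x :: 'a assume t: "0 \<le> t" "t < T"
    show "((\<lambda>s. - w s x) has_real_derivative ut t x / \<epsilon> * w t x) (at t within {0..<T})"
      unfolding w_def using assms(2) by (auto intro!: derivative_eq_intros dt t)
    have sq: "(\<Sum>b\<in>Basis. (Du t x \<bullet> b)\<^sup>2) = (norm (Du t x))\<^sup>2"
      unfolding power2_norm_eq_inner by (subst euclidean_inner) (simp add: power2_eq_square)
    have "(\<Sum>b\<in>Basis. blinfun_apply (D2u t x) b \<bullet> b / \<epsilon> - (Du t x \<bullet> b)\<^sup>2 / \<epsilon>\<^sup>2)
        = blinfun_trace (D2u t x) / \<epsilon> - (norm (Du t x))\<^sup>2 / \<epsilon>\<^sup>2"
      by (simp add: sum_subtractf sum_divide_distrib[symmetric] sq blinfun_trace_def)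
    moreover have "a / \<epsilon> * h + \<epsilon> / 2 * ((q / \<epsilon> - r / \<epsilon>\<^sup>2) * h) = (a + \<epsilon> / 2 * q - r / 2) / \<epsilon> * h"
      for a h q r :: real
      using assms(2) by (simp add: field_simps power2_eq_square)
    ultimately have "ut t x / \<epsilon> * w t x + \<epsilon> / 2 *
        (\<Sum>b\<in>Basis. (blinfun_apply (D2u t x) b \<bullet> b / \<epsilon> - (Du t x \<bullet> b)\<^sup>2 / \<epsilon>\<^sup>2) * w t x)
        = (ut t x + \<epsilon> / 2 * blinfun_trace (D2u t x) - hamiltonian (Du t x)) / \<epsilon> * w t x"
      unfolding sum_distrib_right[symmetric] hamiltonian_def by simp
    also have "\<dots> = 0" using eq[OF t, of x] by simp
    finally show "ut t x / \<epsilon> * w t x + \<epsilon> / 2 *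
        (\<Sum>b\<in>Basis. (blinfun_apply (D2u t x) b \<bullet> b / \<epsilon> - (Du t x \<bullet> b)\<^sup>2 / \<epsilon>\<^sup>2) * w t x) \<le> 0"
      by simp
    fix b :: 'a
    show "((\<lambda>s. - w t (x + s *\<^sub>R b)) has_real_derivative Du t x \<bullet> b / \<epsilon> * w t x) (at 0)"
      using DERIV_minus[OF w_line[OF t]] by simp
    show "((\<lambda>s. Du t (x + s *\<^sub>R b) \<bullet> b / \<epsilon> * w t (x + s *\<^sub>R b)) has_real_derivative
        (blinfun_apply (D2u t x) b \<bullet> b / \<epsilon> - (Du t x \<bullet> b)\<^sup>2 / \<epsilon>\<^sup>2) * w t x) (at 0)"
      using DERIV_mult[OF DERIV_cdivide[OF dxx_line[OF t]] w_line[OF t]]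
      by (simp add: algebra_simps power2_eq_square)
  qed
  then show ?thesis unfolding w_def .
qed

section \<open>The exponential barrier and comparison with heat supersolutions\<close>

text \<open>The index vectors \<open>a\<close> are \<open>\<plusminus> (K / \<epsilon>) b\<close> for the basis vectors \<open>b\<close>, so this is a sum of hyperbolic
  cosines with a time factor that makes each summand solve the heat equation.\<close>

definition exp_barrier :: "real \<Rightarrow> real \<Rightarrow> real \<Rightarrow> 'a::euclidean_space \<Rightarrow> real \<Rightarrow> 'a \<Rightarrow> real" where
  "exp_barrier \<epsilon> T K x0 t x = (\<Sum>a\<in>(*\<^sub>R) (K / \<epsilon>) ` Basis \<union> (*\<^sub>R) (- K / \<epsilon>) ` Basis.
     exp (a \<bullet> (x - x0) + \<epsilon> / 2 * (norm a)\<^sup>2 * (T - t)))"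

lemma heat_supersolution_exp_barrier: "heat_supersolution \<epsilon> T (exp_barrier \<epsilon> T K x0)"
  unfolding exp_barrier_def[abs_def] by (intro heat_supersolution_sum heat_supersolution_exp) auto

lemma continuous_on_exp_barrier: "continuous_on S (\<lambda>(t, x). exp_barrier \<epsilon> T K x0 t x)"
  unfolding exp_barrier_def case_prod_beta by (intro continuous_intros)

lemma exp_barrier_nonneg: "0 \<le> exp_barrier \<epsilon> T K x0 t x"
  unfolding exp_barrier_def by (intro sum_nonneg) auto

text \<open>All summands are positive, so it is enough to keep the one along the dominant coordinate
  of \<open>x - x0\<close>, with matching sign.\<close>

lemma exp_barrier_ge:
  fixes x0 x :: "'a::euclidean_space"
  assumes "0 < \<epsilon>" "0 \<le> K" "t \<le> T"
  shows "exp (K * (norm (x - x0) / DIM('a)) / \<epsilon>) \<le> exp_barrier \<epsilon> T K x0 t x"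
proof -
  obtain b where b: "b \<in> Basis" "norm (x - x0) \<le> DIM('a) * \<bar>(x - x0) \<bullet> b\<bar>"
    by (rule obtain_dominant_coordinate)
  define a where "a = (if (x - x0) \<bullet> b \<ge> 0 then K / \<epsilon> else - K / \<epsilon>) *\<^sub>R b"
  have "K * (norm (x - x0) / DIM('a)) / \<epsilon> \<le> K * \<bar>(x - x0) \<bullet> b\<bar> / \<epsilon>"
    using b(2) assms by (intro divide_right_mono mult_left_mono) (auto simp: divide_simps mult.commute)
  also have "\<dots> = a \<bullet> (x - x0)"
    unfolding a_def by (simp add: inner_commute)
  also have "\<dots> \<le> a \<bullet> (x - x0) + \<epsilon> / 2 * (norm a)\<^sup>2 * (T - t)"
    using assms by simp
  finally have "exp (K * (norm (x - x0) / DIM('a)) / \<epsilon>)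
      \<le> exp (a \<bullet> (x - x0) + \<epsilon> / 2 * (norm a)\<^sup>2 * (T - t))" by simp
  also have "\<dots> \<le> exp_barrier \<epsilon> T K x0 t x"
    unfolding exp_barrier_def using b(1)
    by (intro member_le_sum) (auto simp: a_def)
  finally show ?thesis .
qed

text \<open>At the centre only the time factors remain. Every index vector has norm
  \<open>\<bar>K\<bar> / \<epsilon>\<close> and there are at most \<open>2 * DIM('a)\<close> of
  them.\<close>

lemma exp_barrier_center_le:
  fixes x0 :: "'a::euclidean_space"
  assumes "0 < \<epsilon>" "0 \<le> t" "t \<le> T"
  shows "exp_barrier \<epsilon> T K x0 t x0 \<le> 2 * DIM('a) * exp (K\<^sup>2 * T / 2 / \<epsilon>)"
proof -
  define A where "A = (*\<^sub>R) (K / \<epsilon>) ` (Basis::'a set) \<union> (*\<^sub>R) (- K / \<epsilon>) ` Basis"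
  have na: "(norm a)\<^sup>2 = K\<^sup>2 / \<epsilon>\<^sup>2" if "a \<in> A" for a
    using that assms by (auto simp: A_def power_mult_distrib power_divide)
  have "exp_barrier \<epsilon> T K x0 t x0 \<le> (\<Sum>a\<in>A. exp (K\<^sup>2 * T / 2 / \<epsilon>))"
    unfolding exp_barrier_def A_def[symmetric]
  proof (rule sum_mono)
    fix a assume "a \<in> A"
    have "K\<^sup>2 / \<epsilon> / 2 * (T - t) \<le> K\<^sup>2 / \<epsilon> / 2 * T"
      using assms by (intro mult_left_mono) auto
    then show "exp (a \<bullet> (x0 - x0) + \<epsilon> / 2 * (norm a)\<^sup>2 * (T - t)) \<le> exp (K\<^sup>2 * T / 2 / \<epsilon>)"
      using assms na[OF \<open>a \<in> A\<close>] by (simp add: power2_eq_square mult.commute)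
  qed
  also have "\<dots> = card A * exp (K\<^sup>2 * T / 2 / \<epsilon>)" by simp
  also have "\<dots> \<le> (2 * DIM('a)) * exp (K\<^sup>2 * T / 2 / \<epsilon>)"
  proof (rule mult_right_mono)
    have "card A \<le> DIM('a) + DIM('a)"
      unfolding A_def by (intro order_trans[OF card_Un_le] add_mono card_image_le) auto
    then show "real (card A) \<le> 2 * DIM('a)" by simp
  qed simp
  finally show ?thesis by simp
qed

text \<open>The minimum principle asks for a sign far away, which \<open>W\<close> alone need not
  provide. The bounded gradient lets \<open>- u\<close> grow at most linearly in space, so any
  positive multiple \<open>\<eta>\<close> of a steep enough barrier dominates
  \<open>exp (- u / \<epsilon>)\<close> far from \<open>x0\<close>. The multiple is removed at the
  end by letting \<open>\<eta>\<close> tend to 0 at the fixed point \<open>(t, x0)\<close>.\<close>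

lemma viscous_HJ_le_heat_supersolution:
  fixes u :: "real \<Rightarrow> 'a::euclidean_space \<Rightarrow> real"
  assumes sol: "viscous_HJ_solution \<epsilon> T g u" and "0 < \<epsilon>" and lip: "L-lipschitz_on UNIV g"
    and W: "heat_supersolution \<epsilon> T W" "continuous_on ({0..T} \<times> UNIV) (\<lambda>(t, x). W t x)"
    and W_nonneg: "\<And>t x. 0 \<le> t \<Longrightarrow> t \<le> T \<Longrightarrow> 0 \<le> W t x"
    and terminal: "\<And>x. exp (- g x / \<epsilon>) \<le> W T x"
    and t: "0 \<le> t" "t \<le> T"
  shows "exp (- u t x0 / \<epsilon>) \<le> W t x0"
proof -
  obtain ut Du D2u M where C12: "has_C12_derivatives T u ut Du D2u"
    and M: "\<And>t x. 0 \<le> t \<Longrightarrow> t < T \<Longrightarrow> norm (Du t x) \<le> M"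
    using sol unfolding viscous_HJ_solution_def by (meson atLeastLessThan_iff)
  have uT: "u T x = g x" for x using sol by (simp add: viscous_HJ_solution_def)
  have cont_u: "continuous_on ({0..T} \<times> UNIV) (\<lambda>(t, x). u t x)"
    using sol by (simp add: viscous_HJ_solution_def)
  \<comment> \<open>The gradient bound holds before time \<open>T\<close> only; at \<open>T\<close>
    the Lipschitz constant of \<open>g\<close> takes over.\<close>
  define M' where "M' = max M L"
  have "0 \<le> M'" using lipschitz_on_nonneg[OF lip] by (simp add: M'_def)
  have growth: "- u s x \<le> - u s x0 + M' * norm (x - x0)" if "0 \<le> s" "s \<le> T" for s x
  proof (cases "s = T")
    case True
    have "g x0 - g x \<le> L * norm (x - x0)"
      using lipschitz_onD[OF lip, of x0 x] by (simp add: dist_norm norm_minus_commute)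
    also have "\<dots> \<le> M' * norm (x - x0)" by (intro mult_right_mono) (auto simp: M'_def)
    finally show ?thesis using True by (simp add: uT)
  next
    case False
    then have "s < T" using that by simp
    have "norm (u s x0 - u s x) \<le> M' * norm (x0 - x)"
    proof (rule differentiable_bound[of UNIV "u s" "\<lambda>z h. h \<bullet> Du s z"])
      fix z
      show "(u s has_derivative (\<lambda>h. h \<bullet> Du s z)) (at z within UNIV)"
        using C12 that \<open>s < T\<close> by (auto simp: has_C12_derivatives_def gderiv_def)
      have "\<bar>h \<bullet> Du s z\<bar> \<le> M' * norm h" for h
      proof -
        have "\<bar>h \<bullet> Du s z\<bar> \<le> norm h * norm (Du s z)" by (rule Cauchy_Schwarz_ineq2)
        also have "\<dots> \<le> norm h * M'"
          using M[OF that(1) \<open>s < T\<close>, of z] by (intro mult_left_mono) (auto simp: M'_def)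
        finally show ?thesis by (simp add: mult.commute)
      qed
      then show "onorm (\<lambda>h. h \<bullet> Du s z) \<le> M'" by (intro onorm_le) auto
    qed auto
    then show ?thesis by (simp add: norm_minus_commute)
  qed
  \<comment> \<open>The minimum of \<open>u s x0\<close> over time makes the linear growth bound
    uniform in \<open>s\<close>.\<close>
  have "compact {0..T}" "{0..T} \<noteq> {}" using t by auto
  moreover have "continuous_on {0..T} (\<lambda>s. (\<lambda>(t, x). u t x) (s, x0))"
    by (rule continuous_on_compose2[OF cont_u]) (auto intro!: continuous_intros)
  then have "continuous_on {0..T} (\<lambda>s. u s x0)" by simp
  ultimately obtain s0 where s0: "\<And>s. 0 \<le> s \<Longrightarrow> s \<le> T \<Longrightarrow> u s0 x0 \<le> u s x0"
    using continuous_attains_inf[of "{0..T}" "\<lambda>s. u s x0"] by (meson atLeastAtMost_iff)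
  define c where "c = - u s0 x0"
  \<comment> \<open>The barrier exponent grows like \<open>K / DIM('a)\<close> times the distance.
    The extra 1 leaves a surplus of distance divided by \<open>DIM('a)\<close>, which absorbs the
    constant \<open>c - \<epsilon> * ln \<eta>\<close> outside the radius used below.\<close>
  define K where "K = M' * DIM('a) + 1"
  have "0 \<le> K" using \<open>0 \<le> M'\<close> by (simp add: K_def)
  have approx: "exp (- u t x0 / \<epsilon>) \<le> W t x0 + \<eta> * exp_barrier \<epsilon> T K x0 t x0" if "0 < \<eta>" for \<eta>
  proof -
    have "0 \<le> W t x0 + \<eta> * exp_barrier \<epsilon> T K x0 t x0 + - exp (- u t x0 / \<epsilon>)"
    proof (rule heat_minimum_principle[where \<epsilon>=\<epsilon> and T=T
          and u="\<lambda>t x. W t x + \<eta> * exp_barrier \<epsilon> T K x0 t x + - exp (- u t x / \<epsilon>)"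
          and R="DIM('a) * (c - \<epsilon> * ln \<eta>)" and ?x0.0=x0])
      show "heat_supersolution \<epsilon> T (\<lambda>t x. W t x + \<eta> * exp_barrier \<epsilon> T K x0 t x + - exp (- u t x / \<epsilon>))"
        using \<open>0 < \<eta>\<close> \<open>0 < \<epsilon>\<close>
        by (intro heat_supersolution_add W heat_supersolution_cmult heat_supersolution_exp_barrier
            heat_supersolution_neg_exp_viscous[OF sol]) auto
      show "continuous_on ({0..T} \<times> UNIV)
          (\<lambda>(t, x). W t x + \<eta> * exp_barrier \<epsilon> T K x0 t x + - exp (- u t x / \<epsilon>))"
        using W(2) cont_u continuous_on_exp_barrier[of "{0..T} \<times> UNIV" \<epsilon> T K x0] \<open>0 < \<epsilon>\<close>
        unfolding case_prod_beta by (intro continuous_intros) auto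
      show "0 \<le> W T x + \<eta> * exp_barrier \<epsilon> T K x0 T x + - exp (- u T x / \<epsilon>)" for x
        using terminal[of x] mult_nonneg_nonneg[OF less_imp_le[OF \<open>0 < \<eta>\<close>] exp_barrier_nonneg[of \<epsilon> T K x0 T x]]
        by (simp add: uT)
      fix s and x :: 'a
      assume s: "0 \<le> s" "s \<le> T" and far: "DIM('a) * (c - \<epsilon> * ln \<eta>) \<le> dist x0 x"
      have "c - \<epsilon> * ln \<eta> \<le> norm (x - x0) / DIM('a)"
        using far by (simp add: dist_norm norm_minus_commute field_simps)
      moreover have "- u s x \<le> c + M' * norm (x - x0)"
        using growth[OF s] s0[OF s] by (simp add: c_def) (smt (verit))
      moreover have "K * (norm (x - x0) / DIM('a)) = M' * norm (x - x0) + norm (x - x0) / DIM('a)"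
        by (simp add: K_def field_simps)
      ultimately have "- u s x \<le> \<epsilon> * ln \<eta> + K * (norm (x - x0) / DIM('a))" by linarith
      then have "- u s x / \<epsilon> \<le> ln \<eta> + K * (norm (x - x0) / DIM('a)) / \<epsilon>"
        using \<open>0 < \<epsilon>\<close> by (simp add: field_simps)
      then have "exp (- u s x / \<epsilon>) \<le> exp (ln \<eta> + K * (norm (x - x0) / DIM('a)) / \<epsilon>)"
        by simp
      also have "\<dots> = \<eta> * exp (K * (norm (x - x0) / DIM('a)) / \<epsilon>)"
        using \<open>0 < \<eta>\<close> by (simp add: exp_add)
      also have "\<dots> \<le> \<eta> * exp_barrier \<epsilon> T K x0 s x"
        using exp_barrier_ge[OF \<open>0 < \<epsilon>\<close> \<open>0 \<le> K\<close> s(2), of x x0] \<open>0 < \<eta>\<close> by simp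
      finally show "0 \<le> W s x + \<eta> * exp_barrier \<epsilon> T K x0 s x + - exp (- u s x / \<epsilon>)"
        using W_nonneg[OF s, of x] by simp
    qed (use t \<open>0 < \<epsilon>\<close> in auto)
    then show ?thesis by simp
  qed
  show ?thesis
  proof (rule field_le_epsilon)
    fix e :: real assume "0 < e"
    define B where "B = exp_barrier \<epsilon> T K x0 t x0"
    have "0 \<le> B" unfolding B_def by (rule exp_barrier_nonneg)
    then have "e / (B + 1) * B \<le> e" using \<open>0 < e\<close> by (simp add: field_simps)
    then show "exp (- u t x0 / \<epsilon>) \<le> W t x0 + e"
      using approx[of "e / (B + 1)"] \<open>0 < e\<close> \<open>0 \<le> B\<close> by (simp add: B_def[symmetric])
  qed
qed

section \<open>Viscosity subsolutions lie below shifted paraboloids\<close>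

text \<open>The paraboloid \<open>v\<close> is a classical solution. The term
  \<open>L\<^sup>2 / 2 * \<delta>\<close> puts \<open>v\<close> above \<open>u\<close> at time
  \<open>T\<close>, and far away its quadratic growth beats the linear growth of \<open>u\<close>.
  If \<open>u\<close> exceeded \<open>v\<close>, then \<open>u - v - \<eta> / s\<close> would have a
  positive interior maximum, and testing there with \<open>v + \<eta> / s\<close> would give
  \<open>\<eta> / s\<^sup>2 \<le> 0\<close>.\<close>

lemma viscosity_subsolution_le_paraboloid:
  fixes u :: "real \<Rightarrow> 'a::euclidean_space \<Rightarrow> real"
  assumes sub: "viscosity_subsolution T u"
    and lip: "L-lipschitz_on ({0..T} \<times> UNIV) (\<lambda>(t, x). u t x)"
    and "0 < \<delta>" and t: "0 < t" "t \<le> T"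
  shows "u t x \<le> u T y + (norm (x - y))\<^sup>2 / (2 * (T + \<delta> - t)) + L\<^sup>2 / 2 * \<delta>"
proof (rule ccontr)
  define v where "v s z = u T y + L\<^sup>2 / 2 * \<delta> + (norm (z - y))\<^sup>2 / (2 * (T + \<delta> - s))" for s z
  define h where "h s z = u s z - v s z" for s z
  assume "\<not> u t x \<le> u T y + (norm (x - y))\<^sup>2 / (2 * (T + \<delta> - t)) + L\<^sup>2 / 2 * \<delta>"
  then have "0 < h t x" by (simp add: h_def v_def)
  have "0 < T" using t by simp
  have "0 \<le> L" by (rule lipschitz_on_nonneg[OF lip])
  define \<theta> where "\<theta> = T + \<delta>"
  have "0 < \<theta>" using \<open>0 < T\<close> \<open>0 < \<delta>\<close> by (simp add: \<theta>_def)
  have u_le: "u s z \<le> u T y + L * (T - s) + L * norm (z - y)" if "0 \<le> s" "s \<le> T" for s z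
  proof -
    have "u s z - u T y \<le> dist (u s z) (u T y)" by (simp add: dist_real_def)
    also have "\<dots> \<le> L * dist (s, z) (T, y)"
      using lipschitz_onD[OF lip, of "(s, z)" "(T, y)"] that by simp
    also have "\<dots> \<le> L * (dist s T + dist z y)"
      unfolding dist_Pair_Pair using \<open>0 \<le> L\<close>
      by (intro mult_left_mono sqrt_sum_squares_le_sum) auto
    finally show ?thesis using that by (simp add: dist_norm distrib_left)
  qed
  \<comment> \<open>Replacing the denominator by its largest value \<open>2 * \<theta>\<close> makes
    the bound uniform in time.\<close>
  have h_le: "h s z \<le> L * T + L * norm (z - y) - (norm (z - y))\<^sup>2 / (2 * \<theta>)" if "0 \<le> s" "s \<le> T" for s z
  proof -
    have "(norm (z - y))\<^sup>2 / (2 * \<theta>) \<le> (norm (z - y))\<^sup>2 / (2 * (T + \<delta> - s))"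
      using that \<open>0 < \<delta>\<close> by (intro divide_left_mono) (auto simp: \<theta>_def)
    moreover have "L * (T - s) \<le> L * T" using that \<open>0 \<le> L\<close> by (intro mult_left_mono) auto
    moreover have "0 \<le> L\<^sup>2 / 2 * \<delta>" using \<open>0 < \<delta>\<close> by simp
    ultimately show ?thesis using u_le[OF that, of z] by (simp add: h_def v_def)
  qed
  \<comment> \<open>Used twice: with \<open>q = \<delta>\<close> it yields the sign of
    \<open>h\<close> at time \<open>T\<close>, and with \<open>q = \<theta>\<close> the global upper
    bound \<open>B\<close>.\<close>
  have amgm: "L * r - r\<^sup>2 / (2 * q) \<le> L\<^sup>2 / 2 * q" if "0 < q" for r q
  proof -
    have "0 \<le> (r - L * q)\<^sup>2 / (2 * q)" using that by simp
    also have "\<dots> = L\<^sup>2 / 2 * q - (L * r - r\<^sup>2 / (2 * q))"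
      using that by (simp add: field_simps power2_eq_square)
    finally show ?thesis by simp
  qed
  have hT: "h T z \<le> 0" for z
    using u_le[of T z] amgm[OF \<open>0 < \<delta>\<close>, of "norm (z - y)"] \<open>0 < T\<close> by (simp add: h_def v_def)
  define B where "B = L * T + L\<^sup>2 / 2 * \<theta>"
  have "0 \<le> B" using \<open>0 < T\<close> \<open>0 < \<theta>\<close> \<open>0 \<le> L\<close> by (simp add: B_def)
  have hB: "h s z \<le> B" if "0 \<le> s" "s \<le> T" for s z
    using h_le[OF that, of z] amgm[OF \<open>0 < \<theta>\<close>, of "norm (z - y)"] by (simp add: B_def)
  \<comment> \<open>For \<open>r \<ge> 1\<close> the bound \<open>L * T + L * r\<close> is at most
    \<open>(L + L * T) * r\<close>, and this is at most \<open>r\<^sup>2 / (2 * \<theta>)\<close> by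
    the second entry of the maximum.\<close>
  define R where "R = max 1 (2 * \<theta> * (L + L * T))"
  have far: "h s z \<le> 0" if "0 \<le> s" "s \<le> T" "R \<le> norm (z - y)" for s z
  proof -
    define r where "r = norm (z - y)"
    have r: "1 \<le> r" "2 * \<theta> * (L + L * T) \<le> r" using that by (auto simp: R_def r_def)
    have "L * T * 1 \<le> L * T * r" using r \<open>0 < T\<close> \<open>0 \<le> L\<close> by (intro mult_left_mono) auto
    then have "L * T + L * r \<le> (L + L * T) * r" by (simp add: distrib_right)
    also have "\<dots> \<le> r / (2 * \<theta>) * r"
      using r \<open>0 < \<theta>\<close> by (intro mult_right_mono) (auto simp: field_simps)
    also have "\<dots> = r\<^sup>2 / (2 * \<theta>)" by (simp add: power2_eq_square)
    finally show ?thesis using h_le[OF that(1,2), of z] by (simp add: r_def)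
  qed
  \<comment> \<open>The penalty \<open>\<eta> / s\<close> keeps the maximum away from \<open>s = 0\<close> and makes the test function a strict
    supersolution.\<close>
  define \<eta> where "\<eta> = t * h t x / 2"
  have "0 < \<eta>" using t \<open>0 < h t x\<close> by (simp add: \<eta>_def)
  define F where "F = (\<lambda>(s, z). h s z - \<eta> / s)"
  \<comment> \<open>The penalty at \<open>(t, x)\<close> is exactly half of
    \<open>h t x\<close>.\<close>
  have Ftx: "0 < F (t, x)" using t \<open>0 < h t x\<close> by (simp add: F_def \<eta>_def)
  \<comment> \<open>At time \<open>a\<close> the penalty is at least \<open>B + 1\<close>, more than
    \<open>h\<close> can reach, while \<open>a \<le> t\<close> keeps \<open>(t, x)\<close> in the
    region.\<close>
  define a where "a = min t (\<eta> / (B + 1))"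
  have a: "0 < a" "a \<le> t" using t \<open>0 < \<eta>\<close> \<open>0 \<le> B\<close> by (auto simp: a_def)
  have "B + 1 \<le> \<eta> / a"
  proof -
    have "a \<le> \<eta> / (B + 1)" by (simp add: a_def)
    then show ?thesis using a \<open>0 \<le> B\<close> by (simp add: field_simps)
  qed
  then have Fa: "F (a, z) < 0" for z
    using hB[of a z] a t by (simp add: F_def)
  define S where "S = {a..T} \<times> cball y R"
  have Ffar: "F (s, z) \<le> 0" if "a \<le> s" "s \<le> T" "(s, z) \<notin> S" for s z
  proof -
    have "R \<le> norm (z - y)" using that by (simp add: S_def dist_norm norm_minus_commute)
    moreover have "0 \<le> \<eta> / s" using that a \<open>0 < \<eta>\<close> by simp
    ultimately show ?thesis using far[of s z] that a by (simp add: F_def)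
  qed
  have "(t, x) \<in> S" using Ffar[of t x] Ftx a t by force
  have "compact S" unfolding S_def by (intro compact_Times) auto
  moreover have "S \<noteq> {}" using \<open>(t, x) \<in> S\<close> by auto
  moreover have "continuous_on S F"
  proof -
    have "continuous_on S (\<lambda>(s, z). u s z)"
      using lipschitz_on_continuous_on[OF lip]
      by (rule continuous_on_subset) (use a in \<open>auto simp: S_def\<close>)
    then show ?thesis
      unfolding F_def h_def v_def case_prod_beta
      by (intro continuous_intros) (use a \<open>0 < \<delta>\<close> in \<open>auto simp: S_def\<close>)
  qed
  ultimately obtain p where p: "p \<in> S" "\<And>q. q \<in> S \<Longrightarrow> F q \<le> F p"
    using continuous_attains_sup[of S F] by auto
  obtain s z where sz: "p = (s, z)" by force
  have Fpos: "0 < F (s, z)" using p(2)[OF \<open>(t, x) \<in> S\<close>] Ftx sz by simp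
  have s_bounds: "a \<le> s" "s \<le> T" using p(1) sz by (auto simp: S_def)
  have "s \<noteq> a" using Fpos Fa[of z] by auto
  moreover have "s \<noteq> T"
  proof
    assume "s = T"
    moreover have "0 \<le> \<eta> / T" using \<open>0 < \<eta>\<close> \<open>0 < T\<close> by simp
    ultimately show False using Fpos hT[of z] by (simp add: F_def)
  qed
  ultimately have s: "a < s" "s < T" using s_bounds by auto
  define \<psi> where "\<psi> s z = v s z + \<eta> / s" for s z
  define \<psi>t where "\<psi>t s z = (norm (z - y))\<^sup>2 / (2 * (T + \<delta> - s)\<^sup>2) - \<eta> / s\<^sup>2" for s z
  define D\<psi> where "D\<psi> s z = (1 / (T + \<delta> - s)) *\<^sub>R (z - y)" for s z
  have "has_C1_derivatives T \<psi> \<psi>t D\<psi>"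
    unfolding has_C1_derivatives_def
  proof (intro conjI ballI allI)
    fix s z assume s: "s \<in> {0<..<T}"
    have D: "((\<lambda>r. c / (2 * r)) has_real_derivative - (c / (2 * r\<^sup>2))) (at r)" if "0 < r" for c r :: real
      using that by (auto intro!: derivative_eq_intros simp: power2_eq_square)
    have "((\<lambda>s. T + \<delta> - s) has_real_derivative - 1) (at s)"
      by (auto intro!: derivative_eq_intros)
    from DERIV_chain2[OF D this] s \<open>0 < \<delta>\<close>
    have "((\<lambda>s. (norm (z - y))\<^sup>2 / (2 * (T + \<delta> - s))) has_real_derivative
        (norm (z - y))\<^sup>2 / (2 * (T + \<delta> - s)\<^sup>2)) (at s)"
      by simp
    moreover have "((\<lambda>s. \<eta> / s) has_real_derivative - \<eta> / s\<^sup>2) (at s)"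
      using s by (auto intro!: derivative_eq_intros simp: power2_eq_square)
    ultimately have "((\<lambda>s. u T y + L\<^sup>2 / 2 * \<delta> + (norm (z - y))\<^sup>2 / (2 * (T + \<delta> - s)) + \<eta> / s)
        has_real_derivative 0 + (norm (z - y))\<^sup>2 / (2 * (T + \<delta> - s)\<^sup>2) + - \<eta> / s\<^sup>2) (at s)"
      by (intro DERIV_add DERIV_const)
    then show "((\<lambda>s. \<psi> s z) has_real_derivative \<psi>t s z) (at s)"
      by (simp add: \<psi>_def \<psi>t_def v_def)
    have G: "((\<lambda>z. c + (norm (z - y))\<^sup>2 / (2 * r) + c') has_derivative (\<lambda>k. k \<bullet> (1 / r) *\<^sub>R (z - y))) (at z)"
      if "0 < r" for c c' r :: real
      unfolding power2_norm_eq_inner using that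
      by (auto intro!: derivative_eq_intros simp: inner_commute)
    show "GDERIV (\<psi> s) z :> D\<psi> s z"
      using G[of "T + \<delta> - s" "u T y + L\<^sup>2 / 2 * \<delta>" "\<eta> / s"] s \<open>0 < \<delta>\<close>
      unfolding gderiv_def D\<psi>_def \<psi>_def[abs_def] v_def by simp
  next
    show "continuous_on ({0<..<T} \<times> UNIV) (\<lambda>(t, x). \<psi>t t x)"
      unfolding \<psi>t_def case_prod_beta
      by (intro continuous_intros) (use \<open>0 < \<delta>\<close> in auto)
    show "continuous_on ({0<..<T} \<times> UNIV) (\<lambda>(t, x). D\<psi> t x)"
      unfolding D\<psi>_def case_prod_beta
      by (intro continuous_intros) (use \<open>0 < \<delta>\<close> in auto)
  qed
  moreover have "s \<in> {0<..<T}" using s a by simp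
  \<comment> \<open>Off \<open>S\<close> the function \<open>F\<close> is nonpositive, hence below
    its positive maximum. The maximum therefore holds on the whole open strip, also when
    \<open>z\<close> lies on the boundary of the ball.\<close>
  moreover have "\<forall>\<^sub>F (s', z') in nhds (s, z). u s' z' - \<psi> s' z' \<le> u s z - \<psi> s z"
    unfolding eventually_nhds
  proof (intro exI conjI ballI)
    show "open ({a<..<T} \<times> (UNIV :: 'a set))" by (intro open_Times) auto
    show "(s, z) \<in> {a<..<T} \<times> UNIV" using s by simp
    fix q :: "real \<times> 'a" assume q: "q \<in> {a<..<T} \<times> UNIV"
    obtain s' z' where q': "q = (s', z')" by force
    have "F q \<le> F (s, z)"
    proof (cases "q \<in> S")
      case True
      then show ?thesis using p(2) sz by simp
    next
      case False
      then show ?thesis using Ffar[of s' z'] q q' Fpos by simp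
    qed
    then show "case q of (s', z') \<Rightarrow> u s' z' - \<psi> s' z' \<le> u s z - \<psi> s z"
      by (simp add: q' F_def h_def \<psi>_def)
  qed
  ultimately have "- \<psi>t s z + hamiltonian (D\<psi> s z) \<le> 0"
    by (rule sub[unfolded viscosity_subsolution_def, rule_format])
  moreover have "hamiltonian (D\<psi> s z) = (norm (z - y))\<^sup>2 / (2 * (T + \<delta> - s)\<^sup>2)"
    by (simp add: hamiltonian_def D\<psi>_def power_divide)
  ultimately have "\<eta> / s\<^sup>2 \<le> 0" by (simp add: \<psi>t_def)
  moreover have "0 < \<eta> / s\<^sup>2" using s a \<open>0 < \<eta>\<close> by simp
  ultimately show False by simp
qed

section \<open>Dominating the terminal data by a grid of Gaussians\<close>

text \<open>Each coordinate of \<open>(x - x0) / \<epsilon>\<close> is rounded down, so it moves by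
  at most one mesh width. Extensional index functions form a finite set of known cardinality, which
  is what produces the power of \<open>1 / \<epsilon>\<close>.\<close>

lemma grid_approximation:
  fixes x x0 :: "'a::euclidean_space" and \<epsilon> :: real
  assumes "0 < \<epsilon>" and near: "norm (x - x0) \<le> R"
  obtains k where "k \<in> Basis \<rightarrow>\<^sub>E {- \<lceil>R / \<epsilon>\<rceil>..\<lceil>R / \<epsilon>\<rceil>}"
    "norm (x - (x0 + (\<Sum>b\<in>Basis. (\<epsilon> * real_of_int (k b)) *\<^sub>R b))) \<le> DIM('a) * \<epsilon>"
proof
  define k where "k = restrict (\<lambda>b. \<lfloor>(x - x0) \<bullet> b / \<epsilon>\<rfloor>) (Basis :: 'a set)"
  show "k \<in> Basis \<rightarrow>\<^sub>E {- \<lceil>R / \<epsilon>\<rceil>..\<lceil>R / \<epsilon>\<rceil>}"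
    unfolding k_def
  proof (rule restrict_PiE_iff[THEN iffD2], rule ballI)
    fix b :: 'a assume "b \<in> Basis"
    then have "\<bar>(x - x0) \<bullet> b\<bar> \<le> R" using Basis_le_norm[of b "x - x0"] near by linarith
    then have "\<bar>(x - x0) \<bullet> b / \<epsilon>\<bar> \<le> R / \<epsilon>"
      using \<open>0 < \<epsilon>\<close> by (simp add: abs_divide divide_right_mono)
    then show "\<lfloor>(x - x0) \<bullet> b / \<epsilon>\<rfloor> \<in> {- \<lceil>R / \<epsilon>\<rceil>..\<lceil>R / \<epsilon>\<rceil>}"
      unfolding atLeastAtMost_iff by linarith
  qed
  show "norm (x - (x0 + (\<Sum>b\<in>Basis. (\<epsilon> * real_of_int (k b)) *\<^sub>R b))) \<le> DIM('a) * \<epsilon>"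
  proof (rule norm_le_DIM_times)
    fix b :: 'a assume b: "b \<in> Basis"
    define q where "q = (x - x0) \<bullet> b / \<epsilon>"
    have "\<epsilon> * q = (x - x0) \<bullet> b" using \<open>0 < \<epsilon>\<close> by (simp add: q_def)
    then have "(x - (x0 + (\<Sum>b\<in>Basis. (\<epsilon> * real_of_int (k b)) *\<^sub>R b))) \<bullet> b = \<epsilon> * (q - \<lfloor>q\<rfloor>)"
      using b by (simp add: k_def q_def inner_diff_left inner_add_left right_diff_distrib)
    moreover have "\<bar>q - \<lfloor>q\<rfloor>\<bar> \<le> 1" by linarith
    ultimately show "\<bar>(x - (x0 + (\<Sum>b\<in>Basis. (\<epsilon> * real_of_int (k b)) *\<^sub>R b))) \<bullet> b\<bar> \<le> \<epsilon>"
      using \<open>0 < \<epsilon>\<close> by (simp add: abs_mult)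
  qed
qed

text \<open>A dominating function \<open>W\<close> is built around each \<open>x0\<close> and
  evaluated only at \<open>x0\<close>. The paraboloids are shifted by \<open>\<epsilon>\<close>
  itself: at time \<open>T\<close> the Gaussians have width of the order of the mesh, and the error
  \<open>P * \<epsilon>\<close> costs only the factor \<open>exp P\<close> after division by
  \<open>\<epsilon>\<close>.\<close>

lemma viscous_HJ_exp_le:
  fixes u u0 :: "real \<Rightarrow> 'a::euclidean_space \<Rightarrow> real"
  assumes "0 < T" and lip: "L-lipschitz_on UNIV g"
    and sol: "viscous_HJ_solution \<epsilon> T g u" and \<epsilon>: "0 < \<epsilon>" "\<epsilon> \<le> 1"
    and paraboloid: "\<And>t x y. 0 < t \<Longrightarrow> t \<le> T \<Longrightarrow>
      u0 t x \<le> g y + (norm (x - y))\<^sup>2 / (2 * (T + \<epsilon> - t)) + P * \<epsilon>"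
    and t: "0 < t" "t \<le> T"
    and D_def: "D = real DIM('a)" and A_def: "A = (L * D + 1)\<^sup>2 * T / 2"
  shows "exp (- u t x0 / \<epsilon>) \<le>
    (exp (L * D + D\<^sup>2 / 2 + P) * (2 * (D * A) + 3) ^ DIM('a) + 2 * D * exp P) / \<epsilon> ^ DIM('a)
      * exp (- u0 t x0 / \<epsilon>)"
proof -
  have "0 \<le> L" by (rule lipschitz_on_nonneg[OF lip])
  have "1 \<le> D" using DIM_positive[where 'a='a] unfolding D_def by linarith
  have "0 \<le> A" using \<open>0 < T\<close> by (simp add: A_def)
  \<comment> \<open>\<open>A\<close> is the exponent, before division by \<open>\<epsilon>\<close>,
    of the barrier bound at \<open>x0\<close>. The slope \<open>K\<close> defined below exceeds
    \<open>L * D\<close> by 1, and this surplus is \<open>norm (x - x0) / D\<close>; it pays for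
    \<open>A\<close> precisely outside the radius \<open>D * A\<close>.\<close>
  define R where "R = D * A"
  have "0 \<le> R" using \<open>0 \<le> A\<close> \<open>1 \<le> D\<close> by (simp add: R_def)
  define K where "K = L * D + 1"
  have "0 \<le> K" using \<open>0 \<le> L\<close> \<open>1 \<le> D\<close> by (simp add: K_def)
  \<comment> \<open>Near \<open>x0\<close>, Gaussians centred on a grid of mesh \<open>\<epsilon>\<close> dominate the terminal data; the number of
    grid points is the source of the factor \<open>\<epsilon> ^ (- d)\<close>. Far from \<open>x0\<close>, the exponential barrier
    dominates, and \<open>A\<close> offsets the growth of the barrier in time.\<close>
  define I where "I = (Basis :: 'a set) \<rightarrow>\<^sub>E {- \<lceil>R / \<epsilon>\<rceil>..\<lceil>R / \<epsilon>\<rceil>}"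
  define y where "y k = x0 + (\<Sum>b\<in>Basis. (\<epsilon> * real_of_int (k b)) *\<^sub>R b)" for k
  define G where "G k t x = exp (- (g (y k) + (norm (x - y k))\<^sup>2 / (2 * (T + \<epsilon> - t))) / \<epsilon>)" for k t x
  \<comment> \<open>Moving to a grid point within \<open>D * \<epsilon>\<close> costs
    \<open>L * D * \<epsilon>\<close> in \<open>g\<close> and
    \<open>(D * \<epsilon>)\<^sup>2 / (2 * \<epsilon>)\<close> in the paraboloid. Divided by
    \<open>\<epsilon>\<close>, the sum is the exponent of \<open>c1\<close>.\<close>
  define c1 where "c1 = exp (L * D + D\<^sup>2 / 2)"
  define c2 where "c2 = exp (- (g x0 + A) / \<epsilon>)"
  define W where "W t x = (\<Sum>k\<in>I. c1 * G k t x) + c2 * exp_barrier \<epsilon> T K x0 t x" for t x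
  have "finite I" unfolding I_def by (intro finite_PiE) auto
  have "exp (- u t x0 / \<epsilon>) \<le> W t x0"
  proof (rule viscous_HJ_le_heat_supersolution[OF sol \<epsilon>(1) lip])
    show "heat_supersolution \<epsilon> T W"
      unfolding W_def[abs_def] G_def c1_def c2_def using \<epsilon> \<open>finite I\<close>
      by (intro heat_supersolution_add heat_supersolution_sum heat_supersolution_cmult
          heat_supersolution_gaussian heat_supersolution_exp_barrier) auto
    show "continuous_on ({0..T} \<times> UNIV) (\<lambda>(t, x). W t x)"
      using continuous_on_exp_barrier[of "{0..T} \<times> UNIV" \<epsilon> T K x0] \<epsilon>
      unfolding W_def G_def case_prod_beta by (intro continuous_intros) auto
    show "0 \<le> W t x" for t x
      unfolding W_def G_def c1_def c2_def
      by (intro add_nonneg_nonneg sum_nonneg mult_nonneg_nonneg exp_barrier_nonneg) auto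
    show "exp (- g x / \<epsilon>) \<le> W T x" for x
    proof (cases "norm (x - x0) \<le> R")
      case True
      obtain k where k: "k \<in> I" and close: "norm (x - y k) \<le> D * \<epsilon>"
        using grid_approximation[OF \<epsilon>(1) True] unfolding I_def y_def D_def by blast
      have "g (y k) - g x \<le> L * norm (x - y k)"
        using lipschitz_onD[OF lip, of "y k" x] by (simp add: dist_norm norm_minus_commute)
      also have "\<dots> \<le> L * (D * \<epsilon>)" using close \<open>0 \<le> L\<close> by (intro mult_left_mono)
      finally have "- g x \<le> - g (y k) + L * D * \<epsilon>" by simp
      moreover have "(norm (x - y k))\<^sup>2 / (2 * \<epsilon>) \<le> (D * \<epsilon>)\<^sup>2 / (2 * \<epsilon>)"
        using close \<epsilon> by (intro divide_right_mono power_mono) auto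
      then have "(norm (x - y k))\<^sup>2 / (2 * \<epsilon>) \<le> D\<^sup>2 / 2 * \<epsilon>"
        using \<epsilon> by (simp add: power_mult_distrib power2_eq_square)
      ultimately have "- g x \<le> (L * D + D\<^sup>2 / 2) * \<epsilon> - (g (y k) + (norm (x - y k))\<^sup>2 / (2 * \<epsilon>))"
        by (simp add: algebra_simps)
      then have "- g x / \<epsilon> \<le> ((L * D + D\<^sup>2 / 2) * \<epsilon> - (g (y k) + (norm (x - y k))\<^sup>2 / (2 * \<epsilon>))) / \<epsilon>"
        using \<epsilon> by (intro divide_right_mono) auto
      also have "\<dots> = (L * D + D\<^sup>2 / 2) + - (g (y k) + (norm (x - y k))\<^sup>2 / (2 * (T + \<epsilon> - T))) / \<epsilon>"
        using \<epsilon> by (simp add: field_simps)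
      finally have "exp (- g x / \<epsilon>) \<le> exp \<dots>" by simp
      also have "\<dots> = c1 * G k T x" by (simp add: exp_add c1_def G_def)
      also have "\<dots> \<le> (\<Sum>k\<in>I. c1 * G k T x)"
        using k \<open>finite I\<close> by (intro member_le_sum) (auto simp: c1_def G_def)
      also have "\<dots> \<le> W T x"
        unfolding W_def using exp_barrier_nonneg[of \<epsilon> T K x0 T x] by (simp add: c2_def)
      finally show ?thesis .
    next
      case False
      define r where "r = norm (x - x0) / D"
      have "A \<le> r" using False \<open>1 \<le> D\<close> by (simp add: r_def R_def field_simps)
      have "g x0 - g x \<le> L * norm (x - x0)"
        using lipschitz_onD[OF lip, of x0 x] by (simp add: dist_norm norm_minus_commute)
      also have "\<dots> = K * r - r" using \<open>1 \<le> D\<close> by (simp add: r_def K_def field_simps)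
      finally have "- g x \<le> - (g x0 + A) + K * r" using \<open>A \<le> r\<close> by simp
      then have "- g x / \<epsilon> \<le> - (g x0 + A) / \<epsilon> + K * r / \<epsilon>"
        unfolding add_divide_distrib[symmetric] using \<epsilon> by (intro divide_right_mono) auto
      then have "exp (- g x / \<epsilon>) \<le> exp (- (g x0 + A) / \<epsilon> + K * r / \<epsilon>)" by simp
      also have "\<dots> = c2 * exp (K * r / \<epsilon>)" by (simp only: exp_add c2_def)
      also have "\<dots> \<le> c2 * exp_barrier \<epsilon> T K x0 T x"
        using exp_barrier_ge[OF \<epsilon>(1) \<open>0 \<le> K\<close>, of T T x x0] by (simp add: c2_def r_def D_def)
      also have "\<dots> \<le> W T x"
        unfolding W_def by (simp add: c1_def G_def sum_nonneg)
      finally show ?thesis .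
    qed
  qed (use t in auto)
  define E where "E = exp (- u0 t x0 / \<epsilon>)"
  have "0 < E" by (simp add: E_def)
  have exp_le_E: "exp (- q / \<epsilon>) \<le> exp P * E" if "u0 t x0 \<le> q + P * \<epsilon>" for q
  proof -
    have "- q / \<epsilon> \<le> P + - u0 t x0 / \<epsilon>" using that \<epsilon> by (simp add: field_simps)
    then have "exp (- q / \<epsilon>) \<le> exp (P + - u0 t x0 / \<epsilon>)" by simp
    then show ?thesis by (simp only: exp_add E_def)
  qed
  have card: "real (card I) \<le> (2 * R + 3) ^ DIM('a) / \<epsilon> ^ DIM('a)"
  proof -
    define N where "N = \<lceil>R / \<epsilon>\<rceil>"
    have "0 \<le> R / \<epsilon>" using \<open>0 \<le> R\<close> \<epsilon> by simp
    then have "0 \<le> N" "N \<le> R / \<epsilon> + 1" unfolding N_def by linarith+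
    \<comment> \<open>This is where \<open>\<epsilon> \<le> 1\<close> turns the count
      \<open>2 * (R / \<epsilon>) + 3\<close> into a multiple of
      \<open>1 / \<epsilon>\<close>.\<close>
    have "3 \<le> 3 / \<epsilon>" using \<epsilon> by (simp add: field_simps)
    have "real (card {- N..N}) = 2 * N + 1" using \<open>0 \<le> N\<close> by simp
    also have "\<dots> \<le> 2 * (R / \<epsilon>) + 3 / \<epsilon>" using \<open>N \<le> R / \<epsilon> + 1\<close> \<open>3 \<le> 3 / \<epsilon>\<close> by simp
    also have "\<dots> = (2 * R + 3) / \<epsilon>" by (simp add: add_divide_distrib)
    finally have "real (card {- N..N}) ^ DIM('a) \<le> ((2 * R + 3) / \<epsilon>) ^ DIM('a)"
      by (intro power_mono) auto
    then show ?thesis by (simp add: I_def N_def[symmetric] card_PiE power_divide)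
  qed
  have near: "(\<Sum>k\<in>I. c1 * G k t x0) \<le> (2 * R + 3) ^ DIM('a) / \<epsilon> ^ DIM('a) * (c1 * (exp P * E))"
  proof -
    have "(\<Sum>k\<in>I. c1 * G k t x0) \<le> (\<Sum>k\<in>I. c1 * (exp P * E))"
    proof (rule sum_mono)
      fix k
      have "G k t x0 \<le> exp P * E" unfolding G_def by (rule exp_le_E, rule paraboloid) (fact t)+
      then show "c1 * G k t x0 \<le> c1 * (exp P * E)" by (simp add: c1_def)
    qed
    also have "\<dots> = card I * (c1 * (exp P * E))" by simp
    also have "\<dots> \<le> (2 * R + 3) ^ DIM('a) / \<epsilon> ^ DIM('a) * (c1 * (exp P * E))"
      using card \<open>0 < E\<close> by (intro mult_right_mono) (auto simp: c1_def)
    finally show ?thesis .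
  qed
  have far: "c2 * exp_barrier \<epsilon> T K x0 t x0 \<le> 1 / \<epsilon> ^ DIM('a) * (2 * D * (exp P * E))"
  proof -
    have "c2 * exp_barrier \<epsilon> T K x0 t x0 \<le> c2 * (2 * D * exp (A / \<epsilon>))"
      using exp_barrier_center_le[OF \<epsilon>(1), of t T K x0] t
      by (intro mult_left_mono) (auto simp: c2_def D_def A_def K_def)
    also have "\<dots> = 2 * D * exp (- g x0 / \<epsilon>)"
      by (simp add: c2_def exp_add[symmetric] add_divide_distrib diff_divide_distrib)
    \<comment> \<open>The paraboloid centred at \<open>x0\<close> itself compares
      \<open>g x0\<close> with \<open>u0 t x0\<close>.\<close>
    also have "\<dots> \<le> 2 * D * (exp P * E)"
      using exp_le_E[of "g x0"] paraboloid[OF t, of x0 x0] \<open>1 \<le> D\<close> by simp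
    also have "\<dots> \<le> 1 / \<epsilon> ^ DIM('a) * (2 * D * (exp P * E))"
    proof -
      have "1 \<le> 1 / \<epsilon> ^ DIM('a)" using \<epsilon> by (simp add: power_le_one)
      then show ?thesis using \<open>1 \<le> D\<close> \<open>0 < E\<close>
        using mult_right_mono[of 1 "1 / \<epsilon> ^ DIM('a)" "2 * D * (exp P * E)"] by simp
    qed
    finally show ?thesis .
  qed
  have "exp (- u t x0 / \<epsilon>) \<le> (2 * R + 3) ^ DIM('a) / \<epsilon> ^ DIM('a) * (c1 * (exp P * E))
      + 1 / \<epsilon> ^ DIM('a) * (2 * D * (exp P * E))"
    using \<open>exp (- u t x0 / \<epsilon>) \<le> W t x0\<close> near far unfolding W_def by linarith
  also have "\<dots> = (c1 * exp P * (2 * R + 3) ^ DIM('a) + 2 * D * exp P) / \<epsilon> ^ DIM('a) * E"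
    by (simp add: add_divide_distrib algebra_simps)
  finally show ?thesis by (simp only: c1_def exp_add R_def E_def)
qed

section \<open>Passing to logarithms\<close>

theorem proposition3p3:
  fixes T :: real
    and g :: "real ^ 'd \<Rightarrow> real"
    and \<phi> :: "real \<Rightarrow> real \<Rightarrow> real ^ 'd \<Rightarrow> real"
    and \<phi>0 :: "real \<Rightarrow> real ^ 'd \<Rightarrow> real"
  assumes "T > 0"
    and "\<exists>L. L-lipschitz_on UNIV g"
    and "\<And>\<epsilon>. \<epsilon> > 0 \<Longrightarrow> viscous_HJ_solution \<epsilon> T g (\<phi> \<epsilon>)"
    and "lipschitz_viscosity_HJ_solution T g \<phi>0"
  shows "\<exists>C>0. \<forall>\<epsilon>\<in>{0<..1/2}. \<forall>t\<in>{0<..T}. \<forall>x.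
           \<phi> \<epsilon> t x - \<phi>0 t x \<ge> real CARD('d) * \<epsilon> * ln \<epsilon> - C * \<epsilon>"
proof -
  obtain L where L: "L-lipschitz_on UNIV g" using assms(2) by blast
  obtain L0 where L0: "L0-lipschitz_on ({0..T} \<times> UNIV) (\<lambda>(t, x). \<phi>0 t x)"
    and sub: "viscosity_subsolution T \<phi>0" and terminal: "\<And>x. \<phi>0 T x = g x"
    using assms(4) unfolding lipschitz_viscosity_HJ_solution_def by blast
  define D where "D = real CARD('d)"
  \<comment> \<open>The additive error of the paraboloid bound for shift \<open>\<epsilon>\<close>,
    divided by \<open>\<epsilon>\<close>. It involves the space-time Lipschitz constant of
    \<open>\<phi>0\<close>, which may differ from that of \<open>g\<close>.\<close>
  define P where "P = L0\<^sup>2 / 2"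
  define A where "A = (L * D + 1)\<^sup>2 * T / 2"
  define C where "C = exp (L * D + D\<^sup>2 / 2 + P) * (2 * (D * A) + 3) ^ CARD('d) + 2 * D * exp P"
  have "0 \<le> A" "0 < D" using \<open>T > 0\<close> by (auto simp: A_def D_def)
  then have "0 < C" unfolding C_def by (intro add_nonneg_pos mult_nonneg_nonneg zero_le_power) auto
  have "\<phi> \<epsilon> t x - \<phi>0 t x \<ge> D * \<epsilon> * ln \<epsilon> - (\<bar>ln C\<bar> + 1) * \<epsilon>"
    if \<epsilon>: "0 < \<epsilon>" "\<epsilon> \<le> 1/2" and t: "0 < t" "t \<le> T" for \<epsilon> t x
  proof -
    have "exp (- \<phi> \<epsilon> t x / \<epsilon>) \<le> C / \<epsilon> ^ DIM(real ^ 'd) * exp (- \<phi>0 t x / \<epsilon>)"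
      using viscous_HJ_exp_le[OF \<open>T > 0\<close> L assms(3)[OF \<epsilon>(1)] \<epsilon>(1) _ _ t _ A_def, of \<phi>0 P x]
        viscosity_subsolution_le_paraboloid[OF sub L0 \<epsilon>(1)] \<epsilon>
      by (simp add: terminal P_def C_def D_def)
    \<comment> \<open>Writing the grid factor as \<open>exp (- D * ln \<epsilon>)\<close> exhibits
      the source of the leading term: multiplying the exponent by \<open>\<epsilon>\<close> turns it
      into \<open>D * \<epsilon> * ln \<epsilon>\<close>.\<close>
    also have "\<dots> = exp (ln C - D * ln \<epsilon> + - \<phi>0 t x / \<epsilon>)"
      unfolding exp_add exp_diff using \<open>0 < C\<close> \<epsilon> by (simp add: D_def exp_of_nat_mult)
    finally have "- \<phi> \<epsilon> t x / \<epsilon> \<le> ln C - D * ln \<epsilon> + - \<phi>0 t x / \<epsilon>" by simp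
    then have "- \<phi> \<epsilon> t x \<le> (ln C - D * ln \<epsilon>) * \<epsilon> + - \<phi>0 t x"
      using \<epsilon> by (simp add: field_simps)
    moreover have "ln C * \<epsilon> \<le> (\<bar>ln C\<bar> + 1) * \<epsilon>" using \<epsilon> by (intro mult_right_mono) auto
    ultimately show ?thesis by (simp add: algebra_simps)
  qed
  \<comment> \<open>The absolute value and the added 1 make the final constant strictly positive
    whatever the sign of \<open>ln C\<close>.\<close>
  then show ?thesis by (intro exI[of _ "\<bar>ln C\<bar> + 1"]) (auto simp: D_def)
qed

end
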